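(* Let $\mathbb{K}$ be a field of characteristic zero. For integers $i\geq 1$ and $l\geq 0$, let $I = {\rm sfBorel}(x_ix_{i+1}\cdots x_{i+l})$ in a polynomial ring $\mathbb{K}[x_1,\ldots,x_n]$ with $n\ge i+l$. Then $$\widehat\alpha(I)=\frac{i+l}{i}.$$ Consequently, for every rational number $\frac{a}{b} \geq 1$, there exists a square-free principal Borel ideal $I$ such that $\widehat{\alpha}(I) = \frac{a}{b}$.
   Context: Let $S=\mathbb{K}[x_1,\ldots,x_n]$. Borel moves: for a monomial $m$, if $x_i \mid m$ and $j<i$, then $x_j\cdot\frac{m}{x_i}$ is called a Borel move of $m$. For a square-free monomial $m\in S$, ${\rm sfBorel}(m)\subseteq S$ is the square-free monomial ideal generated by all square-free monomials that can be obtained from $m$ by a (possibly empty) sequence of Borel moves. An ideal of the form ${\rm sfBorel}(m)$ is called a square-free principal Borel ideal. Waldschmidt constant: for a square-free monomial ideal $I$ with minimal primary decomposition $I=P_1\cap\cdots\cap P_t$, the $q$-th symbolic power is $I^{(q)}=P_1^q\cap\cdots\cap P_t^q$. For a homogeneous ideal $J$, $\alpha(J)$ denotes the smallest degree of a generator of $J$. The Waldschmidt constant of $I$ is $\widehat{\alpha}(I)=\lim_{q\to\infty}\alpha(I^{(q)})/q$. *)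

theory Defs
  imports Complex_Main "HOL-Algebra.Ideal_Product" "HOL-Library.Poly_Mapping"
begin

section \<open>The polynomial ring in n variables\<close>

text \<open>A monomial is its exponent vector, and a polynomial is a finitely supported coefficient
  function on monomials. The types allow variables indexed by all of \<^typ>\<open>nat\<close>; the carrier of
  \<open>poly_ring n\<close> cuts out the polynomials in the variables \<open>x\<^sub>1, \<dots>, x\<^sub>n\<close>.\<close>

type_synonym mon = "nat \<Rightarrow>\<^sub>0 nat"
type_synonym 'k mpoly = "mon \<Rightarrow>\<^sub>0 'k"

definition poly_ring :: "nat \<Rightarrow> 'k::comm_ring_1 mpoly ring" where
  "poly_ring n = \<lparr> carrier = {p. \<forall>m \<in> Poly_Mapping.keys p. Poly_Mapping.keys m \<subseteq> {1..n}},
     mult = (*), one = 1, zero = 0, add = (+) \<rparr>"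

definition mon_degree :: "mon \<Rightarrow> nat" where
  "mon_degree m = (\<Sum>i \<in> Poly_Mapping.keys m. Poly_Mapping.lookup m i)"

definition homogeneous_of_degree :: "nat \<Rightarrow> 'k::zero mpoly \<Rightarrow> bool" where
  "homogeneous_of_degree d p \<longleftrightarrow> (\<forall>m \<in> Poly_Mapping.keys p. mon_degree m = d)"

definition squarefree_mon :: "mon \<Rightarrow> bool" where
  "squarefree_mon m \<longleftrightarrow> (\<forall>i. Poly_Mapping.lookup m i \<le> 1)"

definition mon_poly :: "mon \<Rightarrow> 'k::comm_ring_1 mpoly" where
  "mon_poly m = Poly_Mapping.single m 1"


section \<open>Square-free principal Borel ideals\<close>

text \<open>On exponent vectors, \<open>x\<^sub>j \<cdot> m / x\<^sub>i\<close> becomes \<open>m - e\<^sub>i + e\<^sub>j\<close>; the subtraction does not truncate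
  because \<open>x\<^sub>i\<close> divides \<open>m\<close>.\<close>

definition borel_move :: "mon \<Rightarrow> mon \<Rightarrow> bool" where
  "borel_move m m' \<longleftrightarrow> (\<exists>i j. i \<in> Poly_Mapping.keys m \<and> 1 \<le> j \<and> j < i \<and>
     m' = m - Poly_Mapping.single i 1 + Poly_Mapping.single j 1)"

text \<open>Only the final monomial of a sequence of moves has to be square-free, not the intermediate
  ones.\<close>

definition sfBorel :: "nat \<Rightarrow> mon \<Rightarrow> 'k::comm_ring_1 mpoly set" where
  "sfBorel n m = Idl\<^bsub>poly_ring n\<^esub> (mon_poly ` {m'. borel_move\<^sup>*\<^sup>* m m' \<and> squarefree_mon m'})"

definition sf_principal_Borel_ideal :: "nat \<Rightarrow> 'k::comm_ring_1 mpoly set \<Rightarrow> bool" where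
  "sf_principal_Borel_ideal n I \<longleftrightarrow>
     (\<exists>m. squarefree_mon m \<and> Poly_Mapping.keys m \<subseteq> {1..n} \<and> I = sfBorel n m)"

text \<open>The monomial \<open>x\<^sub>i x\<^bsub>i+1\<^esub> \<cdots> x\<^bsub>i+l\<^esub>\<close>.\<close>

definition interval_mon :: "nat \<Rightarrow> nat \<Rightarrow> mon" where
  "interval_mon i l = (\<Sum>j = i..i + l. Poly_Mapping.single j 1)"


section \<open>Primary decompositions and symbolic powers\<close>

definition primary_ideal :: "'a set \<Rightarrow> ('a, 'b) ring_scheme \<Rightarrow> bool" where
  "primary_ideal Q R \<longleftrightarrow> ideal Q R \<and> Q \<noteq> carrier R \<and>
     (\<forall>x \<in> carrier R. \<forall>y \<in> carrier R. x \<otimes>\<^bsub>R\<^esub> y \<in> Q \<longrightarrow>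
        x \<in> Q \<or> (\<exists>k::nat. 0 < k \<and> y [^]\<^bsub>R\<^esub> k \<in> Q))"

definition ideal_radical :: "('a, 'b) ring_scheme \<Rightarrow> 'a set \<Rightarrow> 'a set" where
  "ideal_radical R Q = {x \<in> carrier R. \<exists>k::nat. x [^]\<^bsub>R\<^esub> k \<in> Q}"

text \<open>Intersecting with the carrier makes the empty intersection the unit ideal.\<close>

definition minimal_primary_decomposition ::
    "('a, 'b) ring_scheme \<Rightarrow> 'a set \<Rightarrow> 'a set set \<Rightarrow> bool" where
  "minimal_primary_decomposition R I F \<longleftrightarrow>
     finite F \<and> (\<forall>Q \<in> F. primary_ideal Q R) \<and>
     I = carrier R \<inter> \<Inter>F \<and>
     inj_on (ideal_radical R) F \<and>
     (\<forall>Q \<in> F. carrier R \<inter> \<Inter>(F - {Q}) \<noteq> I)"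

text \<open>Meant for square-free monomial ideals: these are radical, and the minimal primary
  decomposition of a radical ideal is unique. The power of an ideal is taken in the commutative
  monoid of ideals under multiplication, whose unit is the whole ring.\<close>

definition symbolic_power ::
    "('a, 'b) ring_scheme \<Rightarrow> 'a set \<Rightarrow> nat \<Rightarrow> 'a set" where
  "symbolic_power R I q =
     carrier R \<inter> (\<Inter>P \<in> (THE F. minimal_primary_decomposition R I F). P [^]\<^bsub>ideals_set R\<^esub> q)"


section \<open>The Waldschmidt constant\<close>

text \<open>The least degree of a nonzero generator in a system of homogeneous generators does not depend
  on the system, so ranging over all systems yields the usual invariant.\<close>

definition alpha :: "nat \<Rightarrow> 'k::comm_ring_1 mpoly set \<Rightarrow> nat" where
  "alpha n J = (LEAST d. \<exists>G g. G \<subseteq> carrier (poly_ring n) \<and>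
     (\<forall>h \<in> G. \<exists>e. homogeneous_of_degree e h) \<and> J = Idl\<^bsub>poly_ring n\<^esub> G \<and>
     g \<in> G \<and> g \<noteq> 0 \<and> homogeneous_of_degree d g)"

text \<open>Stated as a relation, so that the existence of the limit is part of the assertion.\<close>

definition has_Waldschmidt_constant :: "nat \<Rightarrow> 'k::comm_ring_1 mpoly set \<Rightarrow> real \<Rightarrow> bool" where
  "has_Waldschmidt_constant n I c \<longleftrightarrow>
     (\<lambda>q. real (alpha n (symbolic_power (poly_ring n) I q)) / real q) \<longlonglongrightarrow> c"

end

theory Submission
  imports Defs
begin

text \<open>Put \<open>N = i + l\<close>. Borel moves preserve the degree and never leave the variables
  \<open>x\<^sub>1, \<dots>, x\<^sub>N\<close>, and every square-free monomial of degree \<open>l + 1\<close> in these variables can be reached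
  from \<open>x\<^sub>i \<cdots> x\<^bsub>i+l\<^esub>\<close>, by moving the largest index first. So the ideal is generated by all
  square-free monomials of degree \<open>l + 1 = N - i + 1\<close> in \<open>N\<close> variables. By the pigeonhole principle
  a monomial is divisible by one of them iff its support meets every \<open>i\<close>-element subset \<open>A\<close> of
  \<open>{1..N}\<close> (\<open>sfBorel_interval_mon\<close>). Hence the ideal is the intersection of the primes
  \<open>P\<^sub>A = (x\<^sub>j : j \<in> A)\<close> with \<open>|A| = i\<close>.

  These primes are pairwise incomparable. An irredundant intersection of finitely many primes has
  no other minimal primary decomposition (\<open>minimal_primary_decomposition_unique\<close>), so the \<open>q\<close>-th
  symbolic power is the intersection of the \<open>P\<^sub>A\<^sup>q\<close>. It is spanned by the monomials whose degree in the
  variables of each \<open>A\<close> is at least \<open>q\<close> (\<open>symbolic_power_every_subset_degree\<close>), and \<open>\<alpha>\<close> of it is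
  the least degree of such a monomial.

  Averaging the inequalities over all \<open>A\<close> shows that this degree is at least \<open>q N / i\<close>
  (\<open>subset_sums_ge_imp_sum_ge\<close>), while the monomial with all exponents equal to
  \<open>\<lfloor>q / i\<rfloor> + 1\<close> shows that it is at most \<open>q N / i + N\<close>. Dividing by \<open>q\<close> gives the limit \<open>N / i\<close>. For a
  rational number \<open>a / b \<ge> 1\<close> take \<open>i = b\<close> and \<open>l = a - b\<close>.\<close>


section \<open>Minimal primary decompositions of intersections of primes\<close>

text \<open>The product of elements of the ideals that lie outside \<open>T\<close> is such a \<open>z\<close>.
  Primality of \<open>T\<close> is a condition on products alone, so that \<open>T\<close> may be the radical of a primary
  ideal without a proof that this radical is closed under addition.\<close>

lemma (in cring) Inter_ideals_avoids:
  assumes "finite F" and "\<And>Q. Q \<in> F \<Longrightarrow> ideal Q R" and "\<one> \<notin> T"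
    and T: "\<And>x y. \<lbrakk>x \<in> carrier R; y \<in> carrier R; x \<otimes> y \<in> T\<rbrakk> \<Longrightarrow> x \<in> T \<or> y \<in> T"
    and "\<And>Q. Q \<in> F \<Longrightarrow> \<not> Q \<subseteq> T"
  shows "\<exists>z \<in> carrier R \<inter> \<Inter>F. z \<notin> T"
  using assms(1,2,5)
proof (induction F rule: finite_induct)
  case empty
  then show ?case using assms(3) by auto
next
  case (insert Q F)
  have "\<exists>z \<in> carrier R \<inter> \<Inter>F. z \<notin> T"
    by (rule insert.IH) (use insert.prems in blast)+
  then obtain z where z: "z \<in> carrier R" "\<And>P. P \<in> F \<Longrightarrow> z \<in> P" "z \<notin> T"
    by blast
  obtain w where w: "w \<in> Q" "w \<notin> T"
    using insert.prems(2)[of Q] by auto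
  interpret Q: ideal Q R
    by (simp add: insert.prems(1))
  have wc: "w \<in> carrier R"
    using w(1) by (rule Q.Icarr)
  have "w \<otimes> z \<in> Q"
    using w(1) z(1) by (rule Q.I_r_closed)
  moreover have "w \<otimes> z \<in> P" if "P \<in> F" for P
    using ideal.I_l_closed[OF insert.prems(1) z(2)[OF that] wc] that by blast
  moreover have "w \<otimes> z \<notin> T"
    using T[OF wc z(1)] w(2) z(3) by blast
  ultimately show ?case
    using wc z(1) by (intro bexI[of _ "w \<otimes> z"]) auto
qed

lemma (in cring) primary_ideal_radical_prime:
  assumes Q: "primary_ideal Q R" and xy: "x \<in> carrier R" "y \<in> carrier R"
    and "x \<otimes> y \<in> ideal_radical R Q"
  shows "x \<in> ideal_radical R Q \<or> y \<in> ideal_radical R Q"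
proof -
  obtain k :: nat where "(x \<otimes> y) [^] k \<in> Q"
    using assms(4) by (auto simp: ideal_radical_def)
  then have "(x [^] k) \<otimes> (y [^] k) \<in> Q"
    using xy by (simp add: nat_pow_distrib)
  then have "x [^] k \<in> Q \<or> (\<exists>j::nat. 0 < j \<and> (y [^] k) [^] j \<in> Q)"
    using Q xy unfolding primary_ideal_def by simp
  then show ?thesis
    using xy by (auto simp: ideal_radical_def nat_pow_pow)
qed

lemma (in cring) primary_ideal_one_notin_radical:
  assumes "primary_ideal Q R"
  shows "\<one> \<notin> ideal_radical R Q"
  using assms ideal.one_imp_carrier
  by (fastforce simp: primary_ideal_def ideal_radical_def)

lemma (in cring) primeideal_imp_primary_ideal:
  assumes "primeideal P R"
  shows "primary_ideal P R"
proof -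
  interpret P: primeideal P R by fact
  have "\<exists>k::nat. 0 < k \<and> y [^] k \<in> P" if "y \<in> P" for y
    using that P.Icarr by (intro exI[of _ "1::nat"]) auto
  then show ?thesis
    unfolding primary_ideal_def using P.is_ideal P.I_notcarr P.I_prime by metis
qed

lemma (in cring) ideal_radical_primeideal:
  assumes "primeideal P R"
  shows "ideal_radical R P = P"
proof -
  interpret P: primeideal P R by fact
  have "x \<in> P" if "x \<in> carrier R" "x [^] (k::nat) \<in> P" for x k
    using that(2)
  proof (induction k)
    case 0
    then show ?case using P.one_imp_carrier P.I_notcarr by simp
  next
    case (Suc k)
    then show ?case using P.I_prime[of "x [^] k" x] that(1) by auto
  qed
  moreover have "\<exists>k::nat. x [^] k \<in> P" if "x \<in> P" for x
    using that P.Icarr by (intro exI[of _ "1::nat"]) auto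
  ultimately show ?thesis
    using P.Icarr unfolding ideal_radical_def by blast
qed

lemma (in cring) prime_contains_Inter:
  assumes "finite F" and "\<And>Q. Q \<in> F \<Longrightarrow> ideal Q R" and P: "primeideal P R"
    and "carrier R \<inter> \<Inter>F \<subseteq> P"
  shows "\<exists>Q \<in> F. Q \<subseteq> P"
proof (rule ccontr)
  interpret P: primeideal P R by fact
  assume "\<not> ?thesis"
  then have "\<exists>z \<in> carrier R \<inter> \<Inter>F. z \<notin> P"
    using assms(1,2) P.I_prime P.one_imp_carrier P.I_notcarr
    by (intro Inter_ideals_avoids) auto
  then show False using assms(4) by blast
qed

lemma (in cring) minimal_primary_decomposition_primes:
  assumes "finite G" and prime: "\<And>P. P \<in> G \<Longrightarrow> primeideal P R"
    and incomp: "\<And>P P'. \<lbrakk>P \<in> G; P' \<in> G; P \<subseteq> P'\<rbrakk> \<Longrightarrow> P = P'"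
  shows "minimal_primary_decomposition R (carrier R \<inter> \<Inter>G) G"
proof -
  have "carrier R \<inter> \<Inter>(G - {P}) \<noteq> carrier R \<inter> \<Inter>G" if P: "P \<in> G" for P
  proof
    assume eq: "carrier R \<inter> \<Inter>(G - {P}) = carrier R \<inter> \<Inter>G"
    have "carrier R \<inter> \<Inter>(G - {P}) \<subseteq> P"
      unfolding eq using P by blast
    then obtain P' where "P' \<in> G - {P}" "P' \<subseteq> P"
      using prime_contains_Inter[of "G - {P}" P] assms(1) prime P primeideal.axioms(1) by blast
    then show False using incomp P by blast
  qed
  moreover have "inj_on (ideal_radical R) G"
    using prime ideal_radical_primeideal by (auto intro!: inj_onI)
  ultimately show ?thesis
    unfolding minimal_primary_decomposition_def
    using assms(1) prime primeideal_imp_primary_ideal by blast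
qed

text \<open>Let \<open>F\<close> be a minimal primary decomposition of the intersection of \<open>G\<close>. A prime
  \<open>P \<in> G\<close> contains some \<open>Q \<in> F\<close>, and the radical of \<open>Q\<close> in turn contains some member of \<open>G\<close>; by
  incomparability that radical is \<open>P\<close>. Now take \<open>y\<close> in all members of \<open>G\<close> except \<open>P\<close>. For \<open>x \<in> P\<close> the
  product \<open>x y\<close> lies in \<open>Q\<close> and no power of \<open>y\<close> does, so \<open>x \<in> Q\<close>, and \<open>Q = P\<close>. Therefore \<open>G \<subseteq> F\<close>, and a
  further component of \<open>F\<close> would be redundant.\<close>

lemma (in cring) minimal_primary_decomposition_unique:
  assumes "finite G" and prime: "\<And>P. P \<in> G \<Longrightarrow> primeideal P R"
    and incomp: "\<And>P P'. \<lbrakk>P \<in> G; P' \<in> G; P \<subseteq> P'\<rbrakk> \<Longrightarrow> P = P'"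
    and F: "minimal_primary_decomposition R (carrier R \<inter> \<Inter>G) F"
  shows "F = G"
proof -
  have fin: "finite F" and prim: "\<And>Q. Q \<in> F \<Longrightarrow> primary_ideal Q R"
    and eq: "carrier R \<inter> \<Inter>G = carrier R \<inter> \<Inter>F"
    and irr: "\<And>Q. Q \<in> F \<Longrightarrow> carrier R \<inter> \<Inter>(F - {Q}) \<noteq> carrier R \<inter> \<Inter>G"
    using F unfolding minimal_primary_decomposition_def by (blast, blast, blast, blast)
  have idF: "ideal Q R" if "Q \<in> F" for Q
    using prim[OF that] by (simp add: primary_ideal_def)
  have idG: "ideal P R" if "P \<in> G" for P
    using prime[OF that] by (rule primeideal.axioms(1))
  have "P \<in> F" if P: "P \<in> G" for P
  proof -
    have "carrier R \<inter> \<Inter>F \<subseteq> P"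
      unfolding eq[symmetric] using P by blast
    then obtain Q where Q: "Q \<in> F" "Q \<subseteq> P"
      using prime_contains_Inter[of F P] fin idF prime[OF P] by blast
    have rad_sub: "ideal_radical R Q \<subseteq> P"
      using ideal_radical_primeideal[OF prime[OF P]] Q(2) unfolding ideal_radical_def by blast
    have Q_sub_rad: "carrier R \<inter> \<Inter>G \<subseteq> ideal_radical R Q"
    proof
      fix x assume x: "x \<in> carrier R \<inter> \<Inter>G"
      then have "x \<in> Q" using eq Q(1) by blast
      then show "x \<in> ideal_radical R Q"
        using x unfolding ideal_radical_def by (auto intro!: exI[of _ "1::nat"])
    qed
    have "\<exists>P' \<in> G. P' \<subseteq> ideal_radical R Q"
    proof (rule ccontr)
      assume "\<not> ?thesis"
      then have "\<exists>z \<in> carrier R \<inter> \<Inter>G. z \<notin> ideal_radical R Q"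
        using primary_ideal_radical_prime[OF prim[OF Q(1)]]
          primary_ideal_one_notin_radical[OF prim[OF Q(1)]] \<open>finite G\<close> idG
        by (intro Inter_ideals_avoids) auto
      then show False using Q_sub_rad by blast
    qed
    then have rad: "ideal_radical R Q = P"
      using incomp P rad_sub by (metis subset_antisym subset_trans)
    have "\<exists>z \<in> carrier R \<inter> \<Inter>(G - {P}). z \<notin> P"
    proof (rule ccontr)
      assume "\<not> ?thesis"
      then have "carrier R \<inter> \<Inter>(G - {P}) \<subseteq> P" by blast
      then obtain P' where "P' \<in> G - {P}" "P' \<subseteq> P"
        using prime_contains_Inter[of "G - {P}" P] \<open>finite G\<close> idG prime[OF P] by blast
      then show False using incomp P by blast
    qed
    then obtain y where y: "y \<in> carrier R" "\<And>P'. P' \<in> G - {P} \<Longrightarrow> y \<in> P'" "y \<notin> P"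
      by blast
    have "x \<in> Q" if x: "x \<in> P" for x
    proof -
      have xc: "x \<in> carrier R"
        using x ideal.Icarr[OF idG[OF P]] by blast
      have "x \<otimes> y \<in> P'" if "P' \<in> G" for P'
        using that ideal.I_r_closed[OF idG[OF that], of x y] ideal.I_l_closed[OF idG[OF that], of y x]
          x xc y by (cases "P' = P") auto
      then have "x \<otimes> y \<in> Q"
        using xc y(1) eq Q(1) by blast
      moreover have "y [^] k \<notin> Q" for k :: nat
        using rad y(1,3) unfolding ideal_radical_def by blast
      ultimately show ?thesis
        using prim[OF Q(1)] xc y(1) unfolding primary_ideal_def by blast
    qed
    then show ?thesis using Q by (metis subsetI subset_antisym)
  qed
  then have GF: "G \<subseteq> F" by blast
  have "F \<subseteq> G"
  proof
    fix Q assume Q: "Q \<in> F"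
    show "Q \<in> G"
    proof (rule ccontr)
      assume "Q \<notin> G"
      then have "carrier R \<inter> \<Inter>(F - {Q}) \<subseteq> carrier R \<inter> \<Inter>G"
        using GF by blast
      moreover have "carrier R \<inter> \<Inter>G \<subseteq> carrier R \<inter> \<Inter>(F - {Q})"
        unfolding eq by blast
      ultimately show False using irr[OF Q] by blast
    qed
  qed
  then show ?thesis using GF by blast
qed

lemma (in cring) symbolic_power_Inter_primes:
  assumes "finite G" and "\<And>P. P \<in> G \<Longrightarrow> primeideal P R"
    and "\<And>P P'. \<lbrakk>P \<in> G; P' \<in> G; P \<subseteq> P'\<rbrakk> \<Longrightarrow> P = P'"
  shows "symbolic_power R (carrier R \<inter> \<Inter>G) q
    = carrier R \<inter> (\<Inter>P \<in> G. P [^]\<^bsub>ideals_set R\<^esub> q)"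
proof -
  have "(THE F. minimal_primary_decomposition R (carrier R \<inter> \<Inter>G) F) = G"
    using minimal_primary_decomposition_primes[OF assms]
      minimal_primary_decomposition_unique[OF assms] by (rule the_equality)
  then show ?thesis by (simp add: symbolic_power_def)
qed


section \<open>Ideals spanned by monomials\<close>

abbreviation vars :: "mon \<Rightarrow> nat set" where
  "vars \<equiv> Poly_Mapping.keys"

abbreviation expo :: "mon \<Rightarrow> nat \<Rightarrow> nat" where
  "expo \<equiv> Poly_Mapping.lookup"

definition monomial_span :: "nat \<Rightarrow> mon set \<Rightarrow> 'k::comm_ring_1 mpoly set" where
  "monomial_span n U = {p \<in> carrier (poly_ring n). Poly_Mapping.keys p \<subseteq> U}"

lemma poly_ring_sel [simp]:
  "mult (poly_ring n) = (*)" "one (poly_ring n) = 1" "zero (poly_ring n) = 0"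
  "add (poly_ring n) = (+)"
  by (simp_all add: poly_ring_def)

lemma in_poly_ring_iff:
  "p \<in> carrier (poly_ring n) \<longleftrightarrow> (\<forall>m \<in> Poly_Mapping.keys p. vars m \<subseteq> {1..n})"
  by (simp add: poly_ring_def)

lemma vars_add: "vars (a + b) = vars a \<union> vars b"
  by (auto simp: in_keys_iff lookup_add)

lemma keys_uminus: "Poly_Mapping.keys (- p :: 'a \<Rightarrow>\<^sub>0 'b::ab_group_add) = Poly_Mapping.keys p"
  by (auto simp: in_keys_iff)

lemma in_keys_mult:
  assumes "m \<in> Poly_Mapping.keys (p * q)"
  obtains a b where "a \<in> Poly_Mapping.keys p" "b \<in> Poly_Mapping.keys q" "m = a + b"
  using keys_mult[of p q] assms by blast

lemma cring_poly_ring: "cring (poly_ring n :: 'k::comm_ring_1 mpoly ring)"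
proof (rule cringI)
  show "abelian_group (poly_ring n :: 'k mpoly ring)"
  proof (rule abelian_groupI)
    fix x y :: "'k mpoly"
    assume x: "x \<in> carrier (poly_ring n)"
    show "\<exists>y \<in> carrier (poly_ring n). y \<oplus>\<^bsub>poly_ring n\<^esub> x = \<zero>\<^bsub>poly_ring n\<^esub>"
      using x by (intro bexI[of _ "- x"]) (auto simp: in_poly_ring_iff keys_uminus)
    assume y: "y \<in> carrier (poly_ring n)"
    show "x \<oplus>\<^bsub>poly_ring n\<^esub> y \<in> carrier (poly_ring n)"
      using x y keys_add[of x y] by (fastforce simp: in_poly_ring_iff)
  qed (auto simp: in_poly_ring_iff algebra_simps)
  show "comm_monoid (poly_ring n :: 'k mpoly ring)"
  proof (rule comm_monoidI)
    fix x y :: "'k mpoly"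
    assume "x \<in> carrier (poly_ring n)" "y \<in> carrier (poly_ring n)"
    then show "x \<otimes>\<^bsub>poly_ring n\<^esub> y \<in> carrier (poly_ring n)"
      by (fastforce simp: in_poly_ring_iff vars_add elim!: in_keys_mult)
  qed (auto simp: in_poly_ring_iff algebra_simps)
qed (auto simp: algebra_simps)

lemma mon_poly_in_poly_ring: "vars m \<subseteq> {1..n} \<Longrightarrow> mon_poly m \<in> carrier (poly_ring n)"
  by (simp add: in_poly_ring_iff mon_poly_def)

lemma mon_poly_in_monomial_span:
  "m \<in> U \<Longrightarrow> vars m \<subseteq> {1..n} \<Longrightarrow> mon_poly m \<in> monomial_span n U"
  by (simp add: monomial_span_def in_poly_ring_iff mon_poly_def)

text \<open>The closure condition on \<open>U\<close> holds for the monomials of any monomial ideal, so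
  spans of this kind reduce statements about such ideals to statements about sets of exponent
  vectors.\<close>

lemma ideal_monomial_span:
  assumes up: "\<And>m c. m \<in> U \<Longrightarrow> m + c \<in> U"
  shows "ideal (monomial_span n U :: 'k::comm_ring_1 mpoly set) (poly_ring n)"
proof -
  interpret S: cring "poly_ring n :: 'k mpoly ring" by (rule cring_poly_ring)
  let ?J = "monomial_span n U :: 'k mpoly set"
  have r: "a * x \<in> ?J" if "a \<in> ?J" "x \<in> carrier (poly_ring n)" for a x
    using that S.m_closed[of a x] up
    by (fastforce simp: monomial_span_def elim!: in_keys_mult)
  show ?thesis
  proof (rule idealI)
    show "subgroup ?J (add_monoid (poly_ring n))"
    proof (rule S.add.subgroupI)
      fix a assume a: "a \<in> ?J"
      have "\<ominus>\<^bsub>poly_ring n\<^esub> a = - a"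
        using a by (intro S.minus_equality) (auto simp: monomial_span_def in_poly_ring_iff keys_uminus)
      then show "\<ominus>\<^bsub>poly_ring n\<^esub> a \<in> ?J"
        using a by (simp add: monomial_span_def in_poly_ring_iff keys_uminus)
      fix b assume b: "b \<in> ?J"
      show "a \<oplus>\<^bsub>poly_ring n\<^esub> b \<in> ?J"
        using a b S.a_closed[of a b] keys_add[of a b] by (auto simp: monomial_span_def)
    next
      have "(0 :: 'k mpoly) \<in> ?J" by (simp add: monomial_span_def in_poly_ring_iff)
      then show "?J \<noteq> {}" by blast
    qed (auto simp: monomial_span_def)
    show "x \<otimes>\<^bsub>poly_ring n\<^esub> a \<in> ?J" "a \<otimes>\<^bsub>poly_ring n\<^esub> x \<in> ?J"
      if "a \<in> ?J" "x \<in> carrier (poly_ring n)" for a x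
      using r[OF that] by (simp_all add: mult.commute)
  qed (rule S.ring_axioms)
qed

lemma sum_of_terms:
  "p = (\<Sum>m \<in> Poly_Mapping.keys p. Poly_Mapping.single m (Poly_Mapping.lookup p m))"
  by (rule poly_mapping_eqI)
    (simp add: lookup_sum lookup_single when_def sum.delta in_keys_iff)

text \<open>Every polynomial is the sum of its terms, and a term is a constant times a
  monomial.\<close>

lemma monomial_span_subset_ideal:
  assumes J: "ideal J (poly_ring n :: 'k::comm_ring_1 mpoly ring)"
    and mono: "\<And>m. m \<in> U \<Longrightarrow> vars m \<subseteq> {1..n} \<Longrightarrow> mon_poly m \<in> J"
  shows "monomial_span n U \<subseteq> J"
proof
  interpret J: ideal J "poly_ring n :: 'k mpoly ring" by fact
  fix p :: "'k mpoly" assume p: "p \<in> monomial_span n U"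
  have "Poly_Mapping.single m (Poly_Mapping.lookup p m) \<in> J" if m: "m \<in> Poly_Mapping.keys p" for m
  proof -
    have "Poly_Mapping.single 0 (Poly_Mapping.lookup p m) * mon_poly m \<in> J"
      using J.I_l_closed[OF mono[of m], of "Poly_Mapping.single 0 (Poly_Mapping.lookup p m)"] p m
      by (auto simp: monomial_span_def in_poly_ring_iff)
    then show ?thesis by (simp add: mon_poly_def mult_single)
  qed
  moreover have "(\<Sum>m\<in>X. f m) \<in> J" if "finite X" "\<And>m. m \<in> X \<Longrightarrow> f m \<in> J"
    for X and f :: "mon \<Rightarrow> 'k mpoly"
    using that
  proof (induction X rule: finite_induct)
    case empty
    show ?case using additive_subgroup.zero_closed[OF J.additive_subgroup_axioms] by simp
  next
    case (insert x X)
    then show ?case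
      using additive_subgroup.a_closed[OF J.additive_subgroup_axioms, of "f x" "sum f X"] by simp
  qed
  ultimately have "(\<Sum>m\<in>Poly_Mapping.keys p.
      Poly_Mapping.single m (Poly_Mapping.lookup p m)) \<in> J"
    by simp
  then show "p \<in> J" using sum_of_terms[of p] by simp
qed

lemma genideal_monomials:
  assumes M: "\<And>m. m \<in> M \<Longrightarrow> vars m \<subseteq> {1..n}"
  shows "Idl\<^bsub>poly_ring n\<^esub> (mon_poly ` M) =
    (monomial_span n {m + c | m c. m \<in> M} :: 'k::comm_ring_1 mpoly set)"
    (is "?I = monomial_span n ?U")
proof
  interpret S: cring "poly_ring n :: 'k mpoly ring" by (rule cring_poly_ring)
  have sub: "mon_poly ` M \<subseteq> carrier (poly_ring n :: 'k mpoly ring)"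
    using M mon_poly_in_poly_ring by blast
  have M_U: "m \<in> ?U" if "m \<in> M" for m
    using that by (force intro: exI[of _ 0])
  have "ideal (monomial_span n ?U :: 'k mpoly set) (poly_ring n)"
    by (rule ideal_monomial_span) (use add.assoc in blast)
  moreover have "mon_poly ` M \<subseteq> (monomial_span n ?U :: 'k mpoly set)"
    using M M_U mon_poly_in_monomial_span by blast
  ultimately show "?I \<subseteq> monomial_span n ?U"
    by (rule S.genideal_minimal)
  have idl: "ideal ?I (poly_ring n)" by (rule S.genideal_ideal[OF sub])
  show "monomial_span n ?U \<subseteq> ?I"
  proof (rule monomial_span_subset_ideal[OF idl])
    fix u assume "u \<in> ?U" and u: "vars u \<subseteq> {1..n}"
    then obtain m c where mc: "m \<in> M" "u = m + c" by blast
    have "mon_poly m \<in> ?I" using S.genideal_self[OF sub] mc(1) by blast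
    then have "(mon_poly c :: 'k mpoly) * mon_poly m \<in> ?I"
      using ideal.I_l_closed[OF idl, of "mon_poly m" "mon_poly c"] u mc(2)
      by (simp add: mon_poly_in_poly_ring vars_add)
    then show "mon_poly u \<in> ?I" by (simp add: mon_poly_def mult_single mc(2) add.commute)
  qed
qed

text \<open>A nonzero homogeneous element of the ideal has the degree of each of its
  monomials, all of which lie in \<open>U\<close>; conversely the monomials of \<open>U\<close> form a homogeneous system of
  generators.\<close>

lemma alpha_monomial_span:
  assumes up: "\<And>m c. m \<in> U \<Longrightarrow> m + c \<in> U"
  shows "alpha n (monomial_span n U :: 'k::comm_ring_1 mpoly set) =
    (LEAST d. \<exists>m \<in> U. vars m \<subseteq> {1..n} \<and> mon_degree m = d)"
proof -
  interpret S: cring "poly_ring n :: 'k mpoly ring" by (rule cring_poly_ring)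
  let ?J = "monomial_span n U :: 'k mpoly set"
  let ?M = "{m \<in> U. vars m \<subseteq> {1..n}}"
  have "(\<exists>G g. G \<subseteq> carrier (poly_ring n) \<and> (\<forall>h \<in> G. \<exists>e. homogeneous_of_degree e h) \<and>
      ?J = Idl\<^bsub>poly_ring n\<^esub> G \<and> g \<in> G \<and> g \<noteq> 0 \<and> homogeneous_of_degree d g) \<longleftrightarrow>
    (\<exists>m \<in> U. vars m \<subseteq> {1..n} \<and> mon_degree m = d)" (is "?A \<longleftrightarrow> ?B") for d
  proof
    assume ?A
    then obtain G g where G: "G \<subseteq> carrier (poly_ring n)" "?J = Idl\<^bsub>poly_ring n\<^esub> G" "g \<in> G" "g \<noteq> 0"
      "homogeneous_of_degree d g"
      by blast
    have "g \<in> ?J" using S.genideal_self[OF G(1)] G(2,3) by blast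
    moreover obtain m where "m \<in> Poly_Mapping.keys g"
      using G(4) by (metis ex_in_conv lookup_not_eq_zero_eq_in_keys lookup_zero poly_mapping_eqI)
    ultimately show ?B
      using G(5) unfolding monomial_span_def in_poly_ring_iff homogeneous_of_degree_def by blast
  next
    assume ?B
    then obtain m where m: "m \<in> ?M" "mon_degree m = d" by blast
    have "Idl\<^bsub>poly_ring n\<^esub> (mon_poly ` ?M) = (monomial_span n {m + c | m c. m \<in> ?M} :: 'k mpoly set)"
      by (rule genideal_monomials) blast
    also have "\<dots> = ?J"
    proof -
      have "u \<in> U \<longleftrightarrow> (\<exists>m c. u = m + c \<and> m \<in> ?M)" if "vars u \<subseteq> {1..n}" for u
        using up that by (metis (mono_tags, lifting) add.right_neutral mem_Collect_eq)
      then show ?thesis by (fastforce simp: monomial_span_def in_poly_ring_iff)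
    qed
    finally have J: "?J = Idl\<^bsub>poly_ring n\<^esub> (mon_poly ` ?M)" by simp
    have hom: "homogeneous_of_degree (mon_degree u) (mon_poly u :: 'k mpoly)" for u
      by (simp add: homogeneous_of_degree_def mon_poly_def)
    show ?A
    proof (intro exI conjI)
      show "mon_poly ` ?M \<subseteq> carrier (poly_ring n :: 'k mpoly ring)"
        using mon_poly_in_poly_ring by blast
      show "\<forall>h \<in> mon_poly ` ?M. \<exists>e. homogeneous_of_degree e (h :: 'k mpoly)"
        using hom by blast
      show "?J = Idl\<^bsub>poly_ring n\<^esub> (mon_poly ` ?M)" by (rule J)
      show "(mon_poly m :: 'k mpoly) \<in> mon_poly ` ?M" using m(1) by blast
      show "(mon_poly m :: 'k mpoly) \<noteq> 0"
        by (metis keys_single keys_zero insert_not_empty mon_poly_def zero_neq_one)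
      show "homogeneous_of_degree d (mon_poly m :: 'k mpoly)" using hom m(2) by blast
    qed
  qed
  then show ?thesis by (simp add: alpha_def)
qed

section \<open>The ideals generated by subsets of the variables\<close>

definition degree_in :: "nat set \<Rightarrow> mon \<Rightarrow> nat" where
  "degree_in A m = (\<Sum>j \<in> A. expo m j)"

text \<open>The power \<open>P\<^sub>A\<^sup>q\<close> of the ideal \<open>P\<^sub>A = (x\<^sub>j : j \<in> A)\<close>, described by its
  monomials, for a finite set \<open>A\<close>. That it is the ideal-theoretic power of \<open>P\<^sub>A\<close> is \<open>variable_ideal_pow\<close> below.\<close>

definition variable_ideal_power :: "nat \<Rightarrow> nat set \<Rightarrow> nat \<Rightarrow> 'k::comm_ring_1 mpoly set" where
  "variable_ideal_power n A q = monomial_span n {m. q \<le> degree_in A m}"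

lemma degree_in_add: "degree_in A (a + b) = degree_in A a + degree_in A b"
  by (simp add: degree_in_def lookup_add sum.distrib)

lemma degree_in_single: "finite A \<Longrightarrow> degree_in A (Poly_Mapping.single j e) = (e when j \<in> A)"
  by (auto simp: degree_in_def lookup_single when_def)

lemma degree_in_pos_iff: "finite A \<Longrightarrow> Suc 0 \<le> degree_in A m \<longleftrightarrow> A \<inter> vars m \<noteq> {}"
  by (auto simp: degree_in_def Suc_le_eq sum_nonneg_eq_0_iff in_keys_iff
      simp flip: neq0_conv)

lemma mon_degree_eq_degree_in: "vars m \<subseteq> A \<Longrightarrow> finite A \<Longrightarrow> mon_degree m = degree_in A m"
  unfolding mon_degree_def degree_in_def
  by (rule sum.mono_neutral_left) (auto simp: in_keys_iff)

lemma degree_in_le_mon_degree: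
  assumes "finite A"
  shows "degree_in A m \<le> mon_degree m"
proof -
  have "degree_in A m \<le> degree_in (A \<union> vars m) m"
    unfolding degree_in_def using assms by (intro sum_mono2) auto
  also have "\<dots> = mon_degree m"
    using assms by (intro mon_degree_eq_degree_in[symmetric]) auto
  finally show ?thesis .
qed

lemma ideal_variable_ideal_power:
  "ideal (variable_ideal_power n A q :: 'k::comm_ring_1 mpoly set) (poly_ring n)"
  unfolding variable_ideal_power_def by (rule ideal_monomial_span) (simp add: degree_in_add)

text \<open>Modulo \<open>P\<^sub>A\<close> a polynomial is congruent to its part that involves no variable of
  \<open>A\<close>. The product of two such parts has no monomial in \<open>P\<^sub>A\<close>, so if it lies in \<open>P\<^sub>A\<close> it is zero, and
  one factor vanishes because polynomials form a domain.\<close>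

lemma primeideal_variable_ideal:
  "primeideal (variable_ideal_power n A 1 :: 'k::idom mpoly set) (poly_ring n)"
proof (rule primeidealI[OF ideal_variable_ideal_power cring_poly_ring])
  interpret S: cring "poly_ring n :: 'k mpoly ring" by (rule cring_poly_ring)
  let ?P = "variable_ideal_power n A 1 :: 'k mpoly set"
  interpret P: ideal ?P "poly_ring n" by (rule ideal_variable_ideal_power)
  have add: "x + y \<in> ?P" if "x \<in> ?P" "y \<in> ?P" for x y
    using additive_subgroup.a_closed[OF P.additive_subgroup_axioms that] by simp
  have "(0 :: mon) \<in> Poly_Mapping.keys (1 :: 'k mpoly)"
    by simp
  moreover have "\<not> 1 \<le> degree_in A 0"
    by (simp add: degree_in_def)
  ultimately have "(1 :: 'k mpoly) \<notin> ?P"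
    unfolding variable_ideal_power_def monomial_span_def by blast
  moreover have "(1 :: 'k mpoly) \<in> carrier (poly_ring n)"
    using S.one_closed by simp
  ultimately show "carrier (poly_ring n) \<noteq> ?P"
    by metis
  have split: "\<exists>r. p - r \<in> ?P \<and> r \<in> carrier (poly_ring n) \<and>
      (\<forall>m \<in> Poly_Mapping.keys r. degree_in A m = 0)"
    if p: "p \<in> carrier (poly_ring n)" for p :: "'k mpoly"
  proof -
    let ?f = "\<lambda>m. Poly_Mapping.lookup p m when degree_in A m = 0"
    have "finite {m. ?f m \<noteq> 0}"
      by (rule finite_subset[OF _ finite_keys[of p]]) (auto simp: in_keys_iff)
    then have "Poly_Mapping.lookup (Abs_poly_mapping ?f) = ?f"
      by (rule lookup_Abs_poly_mapping)
    then obtain r where l: "Poly_Mapping.lookup r = ?f"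
      by blast
    have r: "m \<in> Poly_Mapping.keys r \<longleftrightarrow> m \<in> Poly_Mapping.keys p \<and> degree_in A m = 0"
      and p_r: "m \<in> Poly_Mapping.keys (p - r) \<longleftrightarrow> m \<in> Poly_Mapping.keys p \<and> 1 \<le> degree_in A m" for m
      by (auto simp: in_keys_iff lookup_minus l when_def)
    show ?thesis
      using p unfolding variable_ideal_power_def monomial_span_def in_poly_ring_iff
      by (intro exI[of _ r]) (use r p_r in blast)
  qed
  fix p q :: "'k mpoly"
  assume p: "p \<in> carrier (poly_ring n)" and q: "q \<in> carrier (poly_ring n)"
    and pq: "p \<otimes>\<^bsub>poly_ring n\<^esub> q \<in> ?P"
  obtain r where r: "p - r \<in> ?P" "r \<in> carrier (poly_ring n)"
    "\<forall>m \<in> Poly_Mapping.keys r. degree_in A m = 0"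
    using split[OF p] by blast
  obtain s where s: "q - s \<in> ?P" "s \<in> carrier (poly_ring n)"
    "\<forall>m \<in> Poly_Mapping.keys s. degree_in A m = 0"
    using split[OF q] by blast
  have "r * s \<in> ?P"
  proof -
    have "(p - r) * s \<in> ?P" using P.I_r_closed[OF r(1) s(2)] by simp
    moreover have "p * (q - s) \<in> ?P" using P.I_l_closed[OF s(1) p] by simp
    ultimately have "(p - r) * s + p * (q - s) \<in> ?P" by (rule add)
    moreover have "p * q - r * s = (p - r) * s + p * (q - s)" by (simp add: algebra_simps)
    ultimately have 1: "p * q - r * s \<in> ?P" by simp
    then have "- (p * q - r * s) \<in> ?P"
      unfolding variable_ideal_power_def monomial_span_def in_poly_ring_iff keys_uminus
        mem_Collect_eq .
    then have "p * q + - (p * q - r * s) \<in> ?P"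
      using pq by (intro add) (simp_all only: poly_ring_sel)
    then show ?thesis by simp
  qed
  then have pos: "1 \<le> degree_in A m" if "m \<in> Poly_Mapping.keys (r * s)" for m
    using that unfolding variable_ideal_power_def monomial_span_def by blast
  have "Poly_Mapping.keys (r * s) = {}"
  proof (rule equals0I)
    fix m assume m: "m \<in> Poly_Mapping.keys (r * s)"
    then obtain a b where "a \<in> Poly_Mapping.keys r" "b \<in> Poly_Mapping.keys s" "m = a + b"
      by (rule in_keys_mult)
    then have "degree_in A m = 0" using r(3) s(3) by (simp add: degree_in_add)
    then show False using pos[OF m] by simp
  qed
  then have "r * s = 0"
    by (metis empty_iff lookup_not_eq_zero_eq_in_keys lookup_zero poly_mapping_eqI)
  then have "r = 0 \<or> s = 0" by simp
  then show "p \<in> ?P \<or> q \<in> ?P" using r(1) s(1) by auto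
qed

lemma variable_ideal_subset_iff:
  assumes "A \<subseteq> {1..n}" "finite B"
  shows "(variable_ideal_power n A 1 :: 'k::comm_ring_1 mpoly set) \<subseteq> variable_ideal_power n B 1
    \<longleftrightarrow> A \<subseteq> B"
proof
  have finA: "finite A" using assms(1) finite_subset by blast
  show "variable_ideal_power n A 1 \<subseteq> (variable_ideal_power n B 1 :: 'k mpoly set)" if "A \<subseteq> B"
    using that assms(2) finA
    by (auto simp: variable_ideal_power_def monomial_span_def degree_in_pos_iff)
  assume sub: "(variable_ideal_power n A 1 :: 'k mpoly set) \<subseteq> variable_ideal_power n B 1"
  show "A \<subseteq> B"
  proof
    fix j assume j: "j \<in> A"
    have "(mon_poly (Poly_Mapping.single j 1) :: 'k mpoly) \<in> variable_ideal_power n A 1"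
      unfolding variable_ideal_power_def using j assms(1) finA
      by (intro mon_poly_in_monomial_span) (auto simp: degree_in_single)
    then have "(mon_poly (Poly_Mapping.single j 1) :: 'k mpoly) \<in> variable_ideal_power n B 1"
      using sub by blast
    then show "j \<in> B"
      using assms(2)
      by (auto simp: variable_ideal_power_def monomial_span_def mon_poly_def degree_in_single
          when_def split: if_splits)
  qed
qed

text \<open>In the inductive step, a monomial of degree at least \<open>q + 1\<close> in the variables of \<open>A\<close>
  loses one factor \<open>x\<^sub>j\<close> with \<open>j \<in> A\<close>.\<close>

lemma variable_ideal_pow:
  assumes "finite A"
  shows "(variable_ideal_power n A 1 :: 'k::comm_ring_1 mpoly set)
    [^]\<^bsub>ideals_set (poly_ring n)\<^esub> (q::nat) = variable_ideal_power n A q"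
proof (induction q)
  case 0
  have "(variable_ideal_power n A 0 :: 'k mpoly set) = carrier (poly_ring n)"
    by (auto simp: variable_ideal_power_def monomial_span_def)
  then show ?case by (simp add: ideals_set_def nat_pow_def)
next
  interpret S: cring "poly_ring n :: 'k mpoly ring" by (rule cring_poly_ring)
  let ?P = "\<lambda>q. variable_ideal_power n A q :: 'k mpoly set"
  case (Suc q)
  have idl: "ideal (?P k) (poly_ring n)" for k by (rule ideal_variable_ideal_power)
  have "ideal_prod (poly_ring n) (?P q) (?P 1) = ?P (Suc q)"
  proof
    show "ideal_prod (poly_ring n) (?P q) (?P 1) \<subseteq> ?P (Suc q)"
    proof
      fix x assume "x \<in> ideal_prod (poly_ring n) (?P q) (?P 1)"
      then show "x \<in> ?P (Suc q)"
      proof induction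
        case (prod i j)
        then have "i * j \<in> carrier (poly_ring n)"
          using S.m_closed[of i j] by (simp add: variable_ideal_power_def monomial_span_def)
        then show ?case
          using prod
          by (fastforce simp: variable_ideal_power_def monomial_span_def degree_in_add
              elim!: in_keys_mult)
      next
        case (sum s1 s2)
        then show ?case
          using additive_subgroup.a_closed[OF ideal.axioms(1)[OF idl]] by blast
      qed
    qed
    show "?P (Suc q) \<subseteq> ideal_prod (poly_ring n) (?P q) (?P 1)"
      unfolding variable_ideal_power_def[of n A "Suc q"]
    proof (rule monomial_span_subset_ideal[OF S.ideal_prod_is_ideal[OF idl idl]])
      fix m assume "m \<in> {m. Suc q \<le> degree_in A m}" and m: "vars m \<subseteq> {1..n}"
      then have deg: "Suc q \<le> degree_in A m" by simp
      then obtain j where j: "j \<in> A" "j \<in> vars m"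
        using degree_in_pos_iff[OF assms, of m] by auto
      define m' where "m' = m - Poly_Mapping.single j 1"
      have eq: "m = m' + Poly_Mapping.single j 1"
        using j(2) unfolding m'_def
        by (intro poly_mapping_eqI)
          (auto simp: lookup_add lookup_minus lookup_single when_def in_keys_iff)
      have "(mon_poly m' :: 'k mpoly) \<in> ?P q"
        unfolding variable_ideal_power_def using deg m j(1) assms
        by (intro mon_poly_in_monomial_span) (auto simp: eq degree_in_add degree_in_single vars_add)
      moreover have "(mon_poly (Poly_Mapping.single j 1) :: 'k mpoly) \<in> ?P 1"
        unfolding variable_ideal_power_def using m j assms
        by (intro mon_poly_in_monomial_span) (auto simp: degree_in_single)
      ultimately have "(mon_poly m' :: 'k mpoly) * mon_poly (Poly_Mapping.single j 1)
          \<in> ideal_prod (poly_ring n) (?P q) (?P 1)"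
        using ideal_prod.prod[of _ "?P q" _ "?P 1" "poly_ring n"] by fastforce
      moreover have "(mon_poly m' :: 'k mpoly) * mon_poly (Poly_Mapping.single j 1) = mon_poly m"
        unfolding mon_poly_def mult_single eq[symmetric] by simp
      ultimately show "mon_poly m \<in> ideal_prod (poly_ring n) (?P q) (?P 1)" by simp
    qed
  qed
  then show ?case
    using Suc by (simp add: ideals_set_def nat_pow_def)
qed


section \<open>Intersections over all subsets of a given size\<close>

text \<open>The monomials of the intersection of the \<open>P\<^sub>A\<^sup>q\<close> over all \<open>i\<close>-element subsets \<open>A\<close> of
  \<open>{1..N}\<close>.\<close>

definition every_subset_degree :: "nat \<Rightarrow> nat \<Rightarrow> nat \<Rightarrow> mon set" where
  "every_subset_degree N i q = {m. \<forall>A. A \<subseteq> {1..N} \<and> card A = i \<longrightarrow> q \<le> degree_in A m}"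

lemma every_subset_degree_add:
  "m \<in> every_subset_degree N i q \<Longrightarrow> m + c \<in> every_subset_degree N i q"
  by (auto simp: every_subset_degree_def degree_in_add intro: trans_le_add1)

lemma monomial_span_every_subset_degree:
  "(monomial_span n (every_subset_degree N i q) :: 'k::comm_ring_1 mpoly set) =
    carrier (poly_ring n) \<inter>
      (\<Inter>A \<in> {A. A \<subseteq> {1..N} \<and> card A = i}. variable_ideal_power n A q)"
  by (auto simp: monomial_span_def variable_ideal_power_def every_subset_degree_def)

lemma symbolic_power_every_subset_degree:
  assumes "N \<le> n"
  shows "symbolic_power (poly_ring n)
      (monomial_span n (every_subset_degree N i 1) :: 'k::idom mpoly set) q =
    monomial_span n (every_subset_degree N i q)"
proof -
  interpret S: cring "poly_ring n :: 'k mpoly ring" by (rule cring_poly_ring)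
  let ?X = "{A. A \<subseteq> {1..N} \<and> card A = i}"
  let ?P = "\<lambda>A. variable_ideal_power n A 1 :: 'k mpoly set"
  have fin: "finite A" if "A \<in> ?X" for A
    using that finite_subset[of A "{1..N}"] by blast
  have "symbolic_power (poly_ring n) (carrier (poly_ring n) \<inter> \<Inter>(?P ` ?X)) q =
    carrier (poly_ring n) \<inter> (\<Inter>P \<in> ?P ` ?X. P [^]\<^bsub>ideals_set (poly_ring n)\<^esub> q)"
  proof (rule S.symbolic_power_Inter_primes)
    show "finite (?P ` ?X)"
      by (rule finite_imageI, rule finite_subset[of _ "Pow {1..N}"]) auto
    fix P P' assume "P \<in> ?P ` ?X"
    then obtain A where A: "A \<in> ?X" "P = ?P A" by blast
    show "primeideal P (poly_ring n)"
      unfolding A(2) by (rule primeideal_variable_ideal)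
    assume "P' \<in> ?P ` ?X" "P \<subseteq> P'"
    then obtain B where B: "B \<in> ?X" "P' = ?P B" by blast
    have "A \<subseteq> {1..n}"
      using A(1) assms by fastforce
    then have "A \<subseteq> B"
      using \<open>P \<subseteq> P'\<close> fin[OF B(1)] variable_ideal_subset_iff[of A n B] unfolding A(2) B(2) by blast
    then have "A = B"
      using A(1) B(1) fin[OF B(1)] by (intro card_subset_eq) auto
    then show "P = P'" by (simp add: A(2) B(2))
  qed
  moreover have "(\<Inter>P \<in> ?P ` ?X. P [^]\<^bsub>ideals_set (poly_ring n)\<^esub> q) =
      (\<Inter>A \<in> ?X. variable_ideal_power n A q)"
    using fin by (simp add: variable_ideal_pow del: One_nat_def)
  ultimately show ?thesis
    by (simp add: monomial_span_every_subset_degree)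
qed

text \<open>A set \<open>V \<subseteq> {1..N}\<close> meets every \<open>i\<close>-element subset iff fewer than \<open>i\<close> elements of
  \<open>{1..N}\<close> lie outside \<open>V\<close>.\<close>

lemma every_subset_degree_1_iff:
  assumes "i \<le> N"
  shows "m \<in> every_subset_degree N i 1 \<longleftrightarrow> N < card (vars m \<inter> {1..N}) + i"
proof
  have fin: "finite A" if "A \<subseteq> {1..N}" for A :: "nat set"
    using that finite_subset by blast
  let ?V = "vars m \<inter> {1..N}"
  show "m \<in> every_subset_degree N i 1" if c: "N < card ?V + i"
  proof -
    have "A \<inter> vars m \<noteq> {}" if A: "A \<subseteq> {1..N}" "card A = i" for A
    proof
      assume "A \<inter> vars m = {}"
      then have "card (?V \<union> A) = card ?V + i"
        using A fin[OF A(1)] by (subst card_Un_disjoint) auto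
      moreover have "card (?V \<union> A) \<le> card {1..N}"
        using A by (intro card_mono) auto
      ultimately show False using c by simp
    qed
    then show ?thesis
      using fin by (auto simp: every_subset_degree_def degree_in_pos_iff)
  qed
  assume m: "m \<in> every_subset_degree N i 1"
  show "N < card ?V + i"
  proof (rule ccontr)
    assume "\<not> ?thesis"
    then have "i \<le> card ({1..N} - ?V)"
      by (subst card_Diff_subset) auto
    then obtain A where A: "A \<subseteq> {1..N} - ?V" "card A = i"
      using obtain_subset_with_card_n by metis
    then have "A \<inter> vars m = {}" "A \<subseteq> {1..N}" by auto
    then show False
      using m A(2) degree_in_pos_iff[OF fin, of A m] by (auto simp: every_subset_degree_def)
  qed
qed


section \<open>The squarefree Borel ideal of an interval\<close>

definition set_mon :: "nat set \<Rightarrow> mon" where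
  "set_mon B = (\<Sum>j \<in> B. Poly_Mapping.single j 1)"

lemma expo_set_mon: "finite B \<Longrightarrow> expo (set_mon B) j = (if j \<in> B then 1 else 0)"
  by (simp add: set_mon_def lookup_sum lookup_single when_def)

lemma vars_set_mon: "finite B \<Longrightarrow> vars (set_mon B) = B"
  by (auto simp: in_keys_iff expo_set_mon split: if_splits)

lemma squarefree_set_mon: "finite B \<Longrightarrow> squarefree_mon (set_mon B)"
  by (simp add: squarefree_mon_def expo_set_mon)

lemma degree_in_set_mon:
  assumes "finite A" "finite B"
  shows "degree_in A (set_mon B) = card (A \<inter> B)"
proof -
  have "degree_in A (set_mon B) = (\<Sum>j \<in> A. if j \<in> B then 1 else 0)"
    using assms(2) by (simp add: degree_in_def expo_set_mon)
  also have "\<dots> = (\<Sum>j \<in> A \<inter> B. 1)"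
    using assms(1) by (rule sum.inter_restrict[symmetric])
  finally show ?thesis by simp
qed

lemma interval_mon_eq_set_mon: "interval_mon i l = set_mon {i..i + l}"
  by (simp add: interval_mon_def set_mon_def)

lemma borel_moves_add:
  assumes "borel_move\<^sup>*\<^sup>* m m'"
  shows "borel_move\<^sup>*\<^sup>* (m + c) (m' + c)"
  using assms
proof induction
  case (step m' m'')
  then obtain i j where ij: "i \<in> vars m'" "1 \<le> j" "j < i"
    "m'' = m' - Poly_Mapping.single i 1 + Poly_Mapping.single j 1"
    unfolding borel_move_def by blast
  have "m'' + c = (m' + c) - Poly_Mapping.single i 1 + Poly_Mapping.single j 1"
    using ij(1) unfolding ij(4)
    by (intro poly_mapping_eqI)
      (auto simp: lookup_add lookup_minus lookup_single when_def in_keys_iff)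
  then have "borel_move (m' + c) (m'' + c)"
    using ij(1-3) unfolding borel_move_def vars_add by blast
  with step.IH show ?case by (rule rtranclp.rtrancl_into_rtrancl)
qed simp

lemma borel_moves_single:
  assumes "1 \<le> j" "j \<le> i"
  shows "borel_move\<^sup>*\<^sup>* (Poly_Mapping.single i 1) (Poly_Mapping.single j 1)"
proof (cases "j = i")
  case False
  then have "borel_move (Poly_Mapping.single i 1) (Poly_Mapping.single j 1)"
    using assms unfolding borel_move_def by (intro exI[of _ i] exI[of _ j]) auto
  then show ?thesis by blast
qed simp

text \<open>Induction on \<open>l\<close>: the last variable \<open>x\<^bsub>i+l\<^esub>\<close> is moved to the largest element of
  \<open>B\<close>, and the other elements of \<open>B\<close> are at most \<open>i + l - 1\<close>, so they are reached from the shorter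
  interval. Intermediate monomials may fail to be square-free.\<close>

lemma borel_moves_interval:
  assumes "1 \<le> i" "B \<subseteq> {1..i + l}" "card B = Suc l"
  shows "borel_move\<^sup>*\<^sup>* (interval_mon i l) (set_mon B)"
  using assms(2,3)
proof (induction l arbitrary: B)
  case 0
  then obtain b where "B = {b}" using card_1_singletonE by auto
  then show ?case
    using 0 borel_moves_single[of b i] by (simp add: interval_mon_def set_mon_def)
next
  case (Suc l)
  have fin: "finite B" and ne: "B \<noteq> {}"
    using Suc.prems by (auto intro: finite_subset)
  define b where "b = Max B"
  have b: "b \<in> B" unfolding b_def using fin ne by simp
  have "B - {b} \<subseteq> {1..i + l}"
  proof
    fix x assume x: "x \<in> B - {b}"
    then have "x < b" unfolding b_def using fin by (simp add: le_neq_implies_less)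
    moreover have "b \<le> i + Suc l" using b Suc.prems(1) by auto
    ultimately show "x \<in> {1..i + l}" using x Suc.prems(1) by auto
  qed
  moreover have "card (B - {b}) = Suc l" using Suc.prems(2) b fin by simp
  ultimately have "borel_move\<^sup>*\<^sup>* (interval_mon i l) (set_mon (B - {b}))"
    by (rule Suc.IH)
  then have 1: "borel_move\<^sup>*\<^sup>* (interval_mon i l + Poly_Mapping.single (i + Suc l) 1)
      (set_mon (B - {b}) + Poly_Mapping.single (i + Suc l) 1)"
    by (rule borel_moves_add)
  have "borel_move\<^sup>*\<^sup>* (Poly_Mapping.single (i + Suc l) 1) (Poly_Mapping.single b 1)"
    using b Suc.prems(1) by (intro borel_moves_single) auto
  then have 2: "borel_move\<^sup>*\<^sup>* (Poly_Mapping.single (i + Suc l) 1 + set_mon (B - {b}))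
      (Poly_Mapping.single b 1 + set_mon (B - {b}))"
    by (rule borel_moves_add)
  have "interval_mon i (Suc l) = interval_mon i l + Poly_Mapping.single (i + Suc l) 1"
    by (simp add: interval_mon_def)
  moreover have "set_mon B = Poly_Mapping.single b 1 + set_mon (B - {b})"
    unfolding set_mon_def using sum.remove[OF fin b] by simp
  ultimately show ?case
    using rtranclp_trans[OF 1, of "set_mon B"] 2 by (simp add: add.commute)
qed

lemma borel_moves_invariant:
  assumes "borel_move\<^sup>*\<^sup>* m m'" and "vars m \<subseteq> {1..N}"
  shows "vars m' \<subseteq> {1..N} \<and> degree_in {1..N} m' = degree_in {1..N} m"
  using assms(1)
proof induction
  case base
  then show ?case using assms(2) by simp
next
  case (step m' m'')
  then obtain i j where ij: "i \<in> vars m'" "1 \<le> j" "j < i"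
    "m'' = m' - Poly_Mapping.single i 1 + Poly_Mapping.single j 1"
    unfolding borel_move_def by blast
  define u where "u = m' - Poly_Mapping.single i 1"
  have m': "m' = u + Poly_Mapping.single i 1"
    using ij(1) unfolding u_def
    by (intro poly_mapping_eqI)
      (auto simp: lookup_add lookup_minus lookup_single when_def in_keys_iff)
  have m'': "m'' = u + Poly_Mapping.single j 1"
    using ij(4) by (simp add: u_def)
  have i: "i \<in> {1..N}" using ij(1) step.IH by blast
  then have j: "j \<in> {1..N}" using ij(2,3) by auto
  show ?case
    using step.IH i j unfolding m' m'' vars_add
    by (auto simp: degree_in_add degree_in_single when_def)
qed

lemma sfBorel_interval_mon:
  assumes "1 \<le> i" "i + l \<le> n"
  shows "(sfBorel n (interval_mon i l) :: 'k::comm_ring_1 mpoly set) =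
    monomial_span n (every_subset_degree (i + l) i 1)"
proof -
  let ?N = "i + l"
  let ?M = "{m'. borel_move\<^sup>*\<^sup>* (interval_mon i l) m' \<and> squarefree_mon m'}"
  have inv: "vars m \<subseteq> {1..?N} \<and> Suc l \<le> card (vars m)" if m: "m \<in> ?M" for m
  proof -
    have "vars (interval_mon i l) \<subseteq> {1..?N}"
      unfolding interval_mon_eq_set_mon using assms by (auto simp: vars_set_mon)
    then have v: "vars m \<subseteq> {1..?N}" "degree_in {1..?N} m = degree_in {1..?N} (interval_mon i l)"
      using borel_moves_invariant m by blast+
    have "degree_in {1..?N} (interval_mon i l) = card ({1..?N} \<inter> {i..?N})"
      unfolding interval_mon_eq_set_mon by (rule degree_in_set_mon) simp_all
    also have "{1..?N} \<inter> {i..?N} = {i..?N}" using assms by auto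
    finally have "degree_in {1..?N} m = Suc l" using v(2) by simp
    moreover have "degree_in {1..?N} m = mon_degree m"
      using v(1) by (simp add: mon_degree_eq_degree_in)
    moreover have "mon_degree m \<le> card (vars m)"
      using sum_bounded_above[of "vars m" "expo m" 1] m
      by (simp add: mon_degree_def squarefree_mon_def)
    ultimately show ?thesis using v(1) by simp
  qed
  have "{m + c | m c. m \<in> ?M} = every_subset_degree ?N i 1" (is "?U = _")
  proof (intro subset_antisym subsetI)
    fix u assume "u \<in> ?U"
    then obtain m c where mc: "m \<in> ?M" "u = m + c" by blast
    have "vars m \<inter> {1..?N} = vars m" using inv[OF mc(1)] by blast
    then have "m \<in> every_subset_degree ?N i 1"
      using inv[OF mc(1)] by (subst every_subset_degree_1_iff) auto
    then show "u \<in> every_subset_degree ?N i 1"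
      unfolding mc(2) by (rule every_subset_degree_add)
  next
    fix u assume "u \<in> every_subset_degree ?N i 1"
    then have "Suc l \<le> card (vars u \<inter> {1..?N})"
      by (subst (asm) every_subset_degree_1_iff) auto
    then obtain B where B: "B \<subseteq> vars u \<inter> {1..?N}" "card B = Suc l"
      using obtain_subset_with_card_n by metis
    have fin: "finite B" using B(2) by (simp add: card_ge_0_finite)
    have "set_mon B \<in> ?M"
      using borel_moves_interval[OF assms(1), of B l] B fin squarefree_set_mon by blast
    moreover have "u = set_mon B + (u - set_mon B)"
      using B(1) fin
      by (intro poly_mapping_eqI) (auto simp: lookup_add lookup_minus expo_set_mon in_keys_iff)
    ultimately show "u \<in> ?U" by blast
  qed
  moreover have "(sfBorel n (interval_mon i l) :: 'k mpoly set) = monomial_span n ?U"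
    unfolding sfBorel_def using inv assms(2) by (intro genideal_monomials) fastforce
  ultimately show ?thesis by simp
qed


section \<open>Asymptotics of the least degree\<close>

text \<open>Sum the hypothesis over all \<open>k\<close>-element subsets: each \<open>f j\<close> is counted
  \<open>binomial (N - 1) (k - 1)\<close> times, where \<open>N = card S\<close>, and
  \<open>k binomial N k = N binomial (N - 1) (k - 1)\<close>.\<close>

lemma subset_sums_ge_imp_sum_ge:
  fixes f :: "'a \<Rightarrow> nat"
  assumes S: "finite S" and k: "0 < k" "k \<le> card S"
    and f: "\<And>A. A \<subseteq> S \<Longrightarrow> card A = k \<Longrightarrow> q \<le> (\<Sum>j \<in> A. f j)"
  shows "card S * q \<le> k * (\<Sum>j \<in> S. f j)"
proof -
  let ?X = "{A. A \<subseteq> S \<and> card A = k}"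
  let ?N = "card S"
  have finX: "finite ?X" using S by (intro finite_subset[of ?X "Pow S"]) auto
  \<comment> \<open>By Pascal's rule, since the subsets that avoid \<open>j\<close> are the subsets of \<open>S - {j}\<close>.\<close>
  have count: "card {A \<in> ?X. j \<in> A} = (?N - 1) choose (k - 1)" if j: "j \<in> S" for j
  proof -
    have "card {A. A \<subseteq> S - {j} \<and> card A = k} = (?N - 1) choose k"
      using n_subsets[of "S - {j}" k] S j by simp
    moreover have "card ?X = card {A \<in> ?X. j \<in> A} + card {A. A \<subseteq> S - {j} \<and> card A = k}"
    proof (subst card_Un_disjoint[symmetric])
      show "finite {A \<in> ?X. j \<in> A}" "finite {A. A \<subseteq> S - {j} \<and> card A = k}"
        by (rule finite_subset[OF _ finX], blast)+
    qed (auto intro: arg_cong[where f = card])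
    moreover have "?N choose k = ((?N - 1) choose (k - 1)) + ((?N - 1) choose k)"
      using k by (intro choose_reduce_nat) auto
    ultimately show ?thesis using n_subsets[OF S, of k] by simp
  qed
  have "(?N choose k) * q = (\<Sum>A \<in> ?X. q)"
    using n_subsets[OF S] by simp
  also have "\<dots> \<le> (\<Sum>A \<in> ?X. \<Sum>j \<in> A. f j)"
    using f by (intro sum_mono) auto
  also have "\<dots> = (\<Sum>A \<in> ?X. \<Sum>j | j \<in> S \<and> j \<in> A. f j)"
    by (intro sum.cong refl) auto
  also have "\<dots> = (\<Sum>j \<in> S. \<Sum>A | A \<in> ?X \<and> j \<in> A. f j)"
    by (rule sum.swap_restrict[OF finX S])
  also have "\<dots> = (\<Sum>j \<in> S. ((?N - 1) choose (k - 1)) * f j)"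
    using count by (intro sum.cong refl) simp
  finally have "(?N choose k) * q \<le> ((?N - 1) choose (k - 1)) * (\<Sum>j \<in> S. f j)"
    by (simp add: sum_distrib_left)
  then have "k * (?N choose k) * q \<le> ((?N - 1) choose (k - 1)) * (k * (\<Sum>j \<in> S. f j))"
    by (metis mult.assoc mult.left_commute mult_le_mono2)
  then have "((?N - 1) choose (k - 1)) * (?N * q) \<le> ((?N - 1) choose (k - 1)) * (k * (\<Sum>j \<in> S. f j))"
    unfolding times_binomial_minus1_eq[OF k(1)] by (simp add: mult_ac)
  moreover have "0 < (?N - 1) choose (k - 1)"
    using k by (simp add: zero_less_binomial_iff)
  ultimately show ?thesis by simp
qed

lemma has_Waldschmidt_constant_every_subset_degree:
  assumes "1 \<le> i" "i \<le> N" "N \<le> n"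
  shows "has_Waldschmidt_constant n
    (monomial_span n (every_subset_degree N i 1) :: 'k::idom mpoly set) (real N / real i)"
proof -
  define a where "a q = alpha n (symbolic_power (poly_ring n)
    (monomial_span n (every_subset_degree N i 1) :: 'k mpoly set) q)" for q
  have a: "a q = (LEAST d. \<exists>m \<in> every_subset_degree N i q. vars m \<subseteq> {1..n} \<and> mon_degree m = d)"
    for q
    unfolding a_def symbolic_power_every_subset_degree[OF assms(3)]
    by (rule alpha_monomial_span) (rule every_subset_degree_add)
  have upper: "a q \<le> N * (q div i + 1)"
    and lower: "N * q \<le> i * a q" for q
  proof -
    \<comment> \<open>Equal exponents attain the averaging bound up to rounding \<open>q / i\<close> to an integer.\<close>
    define w where "w = (\<Sum>j = 1..N. Poly_Mapping.single j (q div i + 1))"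
    have ew: "expo w j = (if j \<in> {1..N} then q div i + 1 else 0)" for j
      by (simp add: w_def lookup_sum lookup_single when_def)
    have vw: "vars w \<subseteq> {1..N}" using ew by (auto simp: in_keys_iff split: if_splits)
    have "w \<in> every_subset_degree N i q"
    proof -
      have "q \<le> degree_in A w" if A: "A \<subseteq> {1..N}" "card A = i" for A
      proof -
        have "degree_in A w = (\<Sum>j \<in> A. q div i + 1)"
          unfolding degree_in_def using A(1) ew by (intro sum.cong) auto
        also have "\<dots> = i * (q div i + 1)" using A(2) by simp
        finally show ?thesis
          using assms(1) by (simp add: dividend_less_times_div less_imp_le)
      qed
      then show ?thesis by (simp add: every_subset_degree_def)
    qed
    moreover have dw: "mon_degree w = N * (q div i + 1)"
      using mon_degree_eq_degree_in[OF vw] by (simp add: degree_in_def ew)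
    ultimately have ex: "\<exists>m \<in> every_subset_degree N i q.
        vars m \<subseteq> {1..n} \<and> mon_degree m = N * (q div i + 1)"
      using vw assms(3) by (intro bexI[of _ w]) auto
    then show "a q \<le> N * (q div i + 1)"
      unfolding a by (rule Least_le)
    obtain m where m: "m \<in> every_subset_degree N i q" "mon_degree m = a q"
      using LeastI[of "\<lambda>d. \<exists>m \<in> every_subset_degree N i q. vars m \<subseteq> {1..n} \<and> mon_degree m = d",
          OF ex] unfolding a by blast
    have "card {1..N} * q \<le> i * (\<Sum>j \<in> {1..N}. expo m j)"
      using m(1) assms
      by (intro subset_sums_ge_imp_sum_ge) (auto simp: every_subset_degree_def degree_in_def)
    also have "\<dots> \<le> i * a q"
      using degree_in_le_mon_degree[of "{1..N}" m] m(2) by (simp add: degree_in_def)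
    finally show "N * q \<le> i * a q" by simp
  qed
  have "(\<lambda>q. real (a q) / real q) \<longlonglongrightarrow> real N / real i"
  proof (rule tendsto_sandwich)
    show "\<forall>\<^sub>F q in sequentially. real N / real i \<le> real (a q) / real q"
      using eventually_gt_at_top[of 0]
    proof eventually_elim
      case (elim q)
      have "real N * real q \<le> real i * real (a q)"
        using lower[of q] by (metis of_nat_le_iff of_nat_mult)
      then show ?case using elim assms(1) by (simp add: field_simps)
    qed
    show "\<forall>\<^sub>F q in sequentially. real (a q) / real q \<le> real N / real i + real N / real q"
      using eventually_gt_at_top[of 0]
    proof eventually_elim
      case (elim q)
      have "real (a q) \<le> real N * (real (q div i) + 1)"
        using upper[of q] by (metis of_nat_1 of_nat_add of_nat_le_iff of_nat_mult)
      also have "\<dots> \<le> real N * (real q / real i + 1)"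
        by (intro mult_left_mono add_right_mono of_nat_div_le_of_nat) auto
      finally have "real (a q) / real q \<le> real N * (real q / real i + 1) / real q"
        by (rule divide_right_mono) simp
      also have "\<dots> = real N / real i + real N / real q"
        using elim assms(1) by (simp add: field_simps)
      finally show ?case .
    qed
    show "(\<lambda>q. real N / real i + real N / real q) \<longlonglongrightarrow> real N / real i"
      using tendsto_add[OF tendsto_const lim_const_over_n[of "real N"]] by simp
  qed simp
  then show ?thesis by (simp add: has_Waldschmidt_constant_def a_def)
qed

theorem corollary4p2:
  shows "(\<forall>i l n :: nat. 1 \<le> i \<and> i + l \<le> n \<longrightarrow>
            has_Waldschmidt_constant n
              (sfBorel n (interval_mon i l) :: 'k::field_char_0 mpoly set)
              (real (i + l) / real i)) \<and>
         (\<forall>r :: rat. 1 \<le> r \<longrightarrow>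
            (\<exists>n (I :: 'k mpoly set). sf_principal_Borel_ideal n I \<and>
               has_Waldschmidt_constant n I (of_rat r)))"
proof (intro conjI allI impI)
  have interval: "has_Waldschmidt_constant n
      (sfBorel n (interval_mon i l) :: 'k mpoly set) (real (i + l) / real i)"
    if "1 \<le> i \<and> i + l \<le> n" for i l n
    unfolding sfBorel_interval_mon[OF conjunct1[OF that] conjunct2[OF that]]
    using that by (intro has_Waldschmidt_constant_every_subset_degree) auto
  then show "has_Waldschmidt_constant n
      (sfBorel n (interval_mon i l) :: 'k mpoly set) (real (i + l) / real i)"
    if "1 \<le> i \<and> i + l \<le> n" for i l n
    using that .
  fix r :: rat assume r: "1 \<le> r"
  obtain a b :: int where ab: "r = Fract a b" "0 < b"
    using quotient_of_div Fract_of_int_quotient by (cases r) auto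
  then have "b \<le> a" using r by (simp add: one_le_Fract_iff)
  define i l where "i = nat b" and "l = nat (a - b)"
  have i: "1 \<le> i" using ab(2) by (simp add: i_def)
  have "real (i + l) / real i = of_rat r"
    using ab \<open>b \<le> a\<close> by (simp add: i_def l_def of_rat_rat)
  then have "has_Waldschmidt_constant (i + l)
      (sfBorel (i + l) (interval_mon i l) :: 'k mpoly set) (of_rat r)"
    using interval[of i l "i + l"] i by simp
  moreover have "sf_principal_Borel_ideal (i + l)
      (sfBorel (i + l) (interval_mon i l) :: 'k mpoly set)"
    unfolding sf_principal_Borel_ideal_def
    using i by (intro exI[of _ "interval_mon i l"])
      (auto simp: interval_mon_eq_set_mon vars_set_mon squarefree_set_mon)
  ultimately show "\<exists>n (I :: 'k mpoly set). sf_principal_Borel_ideal n I \<and>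
      has_Waldschmidt_constant n I (of_rat r)"
    by blast
qed

end
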